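(* Let $f=\frac1N\sum_{i=1}^N F_i$ satisfy the spectral upper bound condition with constant $L$, and suppose $f$ is bounded below by $f_{\min}$. For any $w_0\in\mathbb{R}^d$, let $\{w_k\}$ be generated by $w_{k+1}=w_k-\alpha_k\widetilde H_k^{-1}g_k$. Suppose that for every $k\ge0$ the gradient approximation satisfies the deterministic norm condition $$\|g_k-\nabla f(w_k)\|_{A_k}^2\le \theta_k^2\|\nabla f(w_k)\|_{A_k}^2+\iota_k$$ with $A_k=\widetilde H_k^{-1}$, $\theta_k=\tilde\theta_g\in[0,1)$, and $\iota_k>0$ with $\sum_{k=0}^\infty\iota_k=\tilde\iota<\infty$. If $\alpha_k=\alpha$ with $0<\alpha\le\tilde\mu/L$, then $\lim_{k\to\infty}\|\nabla f(w_k)\|^2=0$, and for any positive integer $T$ $$\min_{0\le k\le T-1}\|\nabla f(w_k)\|^2\le\frac{\tilde L}{(1-\tilde\theta_g^2)T}\left(\frac{2(f(w_0)-f_{\min})}{\alpha}+\tilde\iota\right).$$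
   Context: Setting: $f:\mathbb{R}^d\to\mathbb{R}$, $f=\frac1N\sum_{i=1}^N F_i$ with each $F_i$ twice continuously differentiable; for a nonempty sample set $S\subseteq\{1,\dots,N\}$, $F_S=\frac{1}{|S|}\sum_{i\in S}F_i$. The vector $g_k\in\mathbb{R}^d$ is an approximation of $\nabla f(w_k)$. Hessian approximation: sample sets $S_0,S_1,\dots$ are given; for each $k$ there are weights $\gamma_0,\dots,\gamma_k\in[0,1]$ (possibly depending on $k$) with $\sum_{i=0}^k\gamma_i=1$, and $\widehat H_k=\sum_{i=0}^k\gamma_i\nabla^2F_{S_i}(w_i)$. For a symmetric matrix $A=U\Lambda U^T$, $|A|=U|\Lambda|U^T$. For fixed $\tilde\mu>0$, $\widetilde H_k=|\widehat H_k|$ if $\lambda_{\min}(|\widehat H_k|)\ge\tilde\mu$, and $\widetilde H_k=|\widehat H_k|+(\tilde\mu-\lambda_{\min}(|\widehat H_k|))I$ otherwise; thus $\widetilde H_k\succeq\tilde\mu I$. Spectral upper bound condition: for every sample size $|S|$ there is $0<L_{|S|}<\infty$ with $\nabla^2F_S(w)\preceq L_{|S|}I$ for all $w\in\mathbb{R}^d$, and $L_{|S|}\le L<\infty$ for all $|S|$; consequently $\nabla^2 f(w)\preceq LI$ for all $w$. $\tilde L$ denotes a constant with $\widetilde H_k\preceq\tilde LI$ for all $k$ (with $\tilde L\le L+\tilde\mu$). Norms: $\|\cdot\|$ is the Euclidean norm and $\|v\|_A=\sqrt{v^TAv}$ for symmetric positive definite $A$. *)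

theory Defs
  imports "HOL-Analysis.Analysis"
begin

definition grad :: "(real^'n \<Rightarrow> real) \<Rightarrow> real^'n \<Rightarrow> real^'n" where
  "grad f x = (THE D. GDERIV f x :> D)"

definition hessian :: "(real^'n \<Rightarrow> real) \<Rightarrow> real^'n \<Rightarrow> real^'n^'n" where
  "hessian f x = jacobian (grad f) (at x)"

definition twice_continuously_differentiable :: "(real^'n \<Rightarrow> real) \<Rightarrow> bool" where
  "twice_continuously_differentiable f \<longleftrightarrow>
     (\<forall>x. f differentiable (at x)) \<and>
     (\<forall>x. grad f differentiable (at x)) \<and>
     continuous_on UNIV (hessian f)"

definition sample_avg :: "(nat \<Rightarrow> real^'n \<Rightarrow> real) \<Rightarrow> nat set \<Rightarrow> real^'n \<Rightarrow> real" where
  "sample_avg F S w = (1 / real (card S)) * (\<Sum>i\<in>S. F i w)"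

(* The semidefinite order; only ever applied to pairs of symmetric matrices. *)
definition psd_le :: "real^'n^'n \<Rightarrow> real^'n^'n \<Rightarrow> bool"  (infix "\<preceq>" 50) where
  "A \<preceq> B \<longleftrightarrow> (\<forall>v. v \<bullet> (A *v v) \<le> v \<bullet> (B *v v))"

definition mnorm :: "real^'n^'n \<Rightarrow> real^'n \<Rightarrow> real" where
  "mnorm A v = sqrt (v \<bullet> (A *v v))"

definition diag_mat :: "('n \<Rightarrow> real) \<Rightarrow> real^'n^'n" where
  "diag_mat d = (\<chi> i j. if i = j then d i else 0)"

(* |A| = U |D| U^T for a symmetric A = U D U^T with U orthogonal; the result does not
   depend on the chosen diagonalisation. Unspecified if A is not symmetric. *)
definition mat_abs :: "real^'n^'n \<Rightarrow> real^'n^'n" where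
  "mat_abs A = (THE B. \<exists>U d. orthogonal_matrix U \<and>
      A = U ** diag_mat d ** transpose U \<and>
      B = U ** diag_mat (\<lambda>i. \<bar>d i\<bar>) ** transpose U)"

definition eigenvals :: "real^'n^'n \<Rightarrow> real set" where
  "eigenvals A = {l. \<exists>v. v \<noteq> 0 \<and> A *v v = l *\<^sub>R v}"

definition lambda_min :: "real^'n^'n \<Rightarrow> real" where
  "lambda_min A = Min (eigenvals A)"

definition hess_avg ::
  "(nat \<Rightarrow> real^'n \<Rightarrow> real) \<Rightarrow> (nat \<Rightarrow> nat set) \<Rightarrow> (nat \<Rightarrow> nat \<Rightarrow> real) \<Rightarrow> (nat \<Rightarrow> real^'n)
    \<Rightarrow> nat \<Rightarrow> real^'n^'n" where
  "hess_avg F S \<gamma> w k = (\<Sum>i\<le>k. \<gamma> k i *\<^sub>R hessian (sample_avg F (S i)) (w i))"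

definition abs_shift :: "real \<Rightarrow> real^'n^'n \<Rightarrow> real^'n^'n" where
  "abs_shift \<mu> H = (if lambda_min (mat_abs H) \<ge> \<mu> then mat_abs H
     else mat_abs H + (\<mu> - lambda_min (mat_abs H)) *\<^sub>R mat 1)"

(* Ls s is the bound for samples of size s. *)
definition spectral_upper_bound :: "nat \<Rightarrow> (nat \<Rightarrow> real^'n \<Rightarrow> real) \<Rightarrow> real \<Rightarrow> bool" where
  "spectral_upper_bound N F L \<longleftrightarrow>
     (\<exists>Ls :: nat \<Rightarrow> real.
        (\<forall>s\<in>{1..N}. 0 < Ls s \<and> Ls s \<le> L) \<and>
        (\<forall>S. S \<subseteq> {1..N} \<and> S \<noteq> {} \<longrightarrow>
           (\<forall>w. hessian (sample_avg F S) w \<preceq> Ls (card S) *\<^sub>R mat 1)))"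

end

theory Submission
  imports Defs
begin

text \<open>
  The shifted matrix \<open>H\<close> is symmetric with \<open>\<mu> I \<preceq> H \<preceq> L' I\<close>, so its inverse \<open>A\<close> is symmetric and
  satisfies \<open>\<parallel>A g\<parallel>\<^sup>2 \<le> (g \<bullet> A g) / \<mu>\<close> and \<open>\<parallel>v\<parallel>\<^sup>2 \<le> L' (v \<bullet> A v)\<close>. The descent lemma with
  \<open>\<alpha> \<le> \<mu> / L\<close> gives \<open>f (w - \<alpha> A g) \<le> f w - \<alpha> (\<nabla> \<bullet> A g) + (\<alpha>/2) (g \<bullet> A g)\<close>. Completing the
  square in the \<open>A\<close>-norm turns the right-hand side into
  \<open>f w - (\<alpha>/2) \<parallel>\<nabla>\<parallel>\<^sub>A\<^sup>2 + (\<alpha>/2) \<parallel>g - \<nabla>\<parallel>\<^sub>A\<^sup>2\<close>; the norm condition bounds the last term, and summing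
  over the iterations bounds the sum of the squared gradient norms.
\<close>

section \<open>The spectral theorem for symmetric matrices\<close>

text \<open>A maximiser of the Rayleigh quotient on the unit sphere of \<open>V\<close> is an eigenvector.\<close>

lemma selfadjoint_eigenvector_exists:
  fixes T :: "'a::euclidean_space \<Rightarrow> 'a"
  assumes lin: "linear T" and adj: "\<And>x y. T x \<bullet> y = x \<bullet> T y"
    and V: "subspace V" and inv: "\<And>x. x \<in> V \<Longrightarrow> T x \<in> V" and ne: "\<exists>x\<in>V. x \<noteq> 0"
  obtains v l where "v \<in> V" "norm v = 1" "T v = l *\<^sub>R v"
proof -
  let ?K = "V \<inter> sphere 0 1"
  obtain x where x: "x \<in> V" "x \<noteq> 0" using ne by blast
  have "x /\<^sub>R norm x \<in> ?K" using x V by (simp add: subspace_scale)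
  then have ne': "?K \<noteq> {}" by blast
  have comp: "compact ?K" using V closed_subspace by (intro closed_Int_compact) auto
  have cont: "continuous_on ?K (\<lambda>x. x \<bullet> T x)"
    by (intro continuous_intros linear_continuous_on linear_conv_bounded_linear[THEN iffD1] lin)
  obtain v where v: "v \<in> ?K" and vmax: "\<And>y. y \<in> ?K \<Longrightarrow> y \<bullet> T y \<le> v \<bullet> T v"
    using continuous_attains_sup[OF comp ne' cont] by blast
  define l where "l = v \<bullet> T v"
  have vv: "v \<bullet> v = 1" using v by (simp add: dot_square_norm)
  have vV: "v \<in> V" using v by blast
  have q: "u \<bullet> T u \<le> l * (u \<bullet> u)" if "u \<in> V" for u
  proof (cases "u = 0")
    case True then show ?thesis by (simp add: linear_0[OF lin])
  next
    case False
    have "u /\<^sub>R norm u \<in> ?K" using that False V by (simp add: subspace_scale)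
    from vmax[OF this] have "(u \<bullet> T u) / (norm u)\<^sup>2 \<le> l"
      by (simp add: l_def linear_scale[OF lin] divide_simps power2_eq_square)
    then show ?thesis using False by (simp add: divide_simps dot_square_norm)
  qed
  define z where "z = T v - l *\<^sub>R v"
  have zV: "z \<in> V" unfolding z_def using V inv vV by (simp add: subspace_diff subspace_scale)
  have ineq: "2 * t * (z \<bullet> z) \<le> t\<^sup>2 * (l * (z \<bullet> z) - z \<bullet> T z)" for t :: real
  proof -
    have "v + t *\<^sub>R z \<in> V" using V vV zV by (simp add: subspace_add subspace_scale)
    from q[OF this] have "v \<bullet> T v + 2 * t * (z \<bullet> T v) + t\<^sup>2 * (z \<bullet> T z)
        \<le> l * (v \<bullet> v + 2 * t * (z \<bullet> v) + t\<^sup>2 * (z \<bullet> z))"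
      using adj[of v z]
      by (simp add: linear_add[OF lin] linear_scale[OF lin] inner_simps inner_commute
          power2_eq_square algebra_simps)
    moreover have "z \<bullet> T v = z \<bullet> z + l * (z \<bullet> v)"
      using inner_diff_right[of z "T v" "l *\<^sub>R v"] by (simp add: z_def[symmetric])
    ultimately show ?thesis unfolding l_def[symmetric] vv by (simp add: algebra_simps)
  qed
  have "z \<bullet> z = 0"
  proof (rule ccontr)
    assume "z \<bullet> z \<noteq> 0"
    then have pos: "z \<bullet> z > 0" by simp
    define c where "c = \<bar>l * (z \<bullet> z) - z \<bullet> T z\<bar> + 1"
    have c: "c > 0" "l * (z \<bullet> z) - z \<bullet> T z \<le> c" by (auto simp: c_def)
    define t where "t = (z \<bullet> z) / c"
    have t: "t > 0" using pos c by (simp add: t_def)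
    have "2 * t * (z \<bullet> z) \<le> t\<^sup>2 * c"
      using ineq[of t] c t by (meson mult_left_mono order_trans zero_le_power2)
    also have "t\<^sup>2 * c = t * (z \<bullet> z)" using c by (simp add: t_def power2_eq_square)
    finally show False using t pos by simp
  qed
  then have "T v = l *\<^sub>R v" by (simp add: z_def)
  with that vV v show ?thesis by auto
qed

text \<open>A maximal orthonormal set of eigenvectors spans, since its orthogonal complement is invariant.\<close>

lemma selfadjoint_orthonormal_eigenbasis:
  fixes T :: "'a::euclidean_space \<Rightarrow> 'a"
  assumes lin: "linear T" and adj: "\<And>x y. T x \<bullet> y = x \<bullet> T y"
  obtains B where "finite B" "card B = DIM('a)" "pairwise orthogonal B"
    "\<And>b. b \<in> B \<Longrightarrow> norm b = 1 \<and> (\<exists>l. T b = l *\<^sub>R b)"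
proof -
  define P where "P B \<longleftrightarrow> pairwise orthogonal B \<and> (\<forall>b\<in>B. norm b = 1 \<and> (\<exists>l. T b = l *\<^sub>R b))" for B
  have indep: "independent B" if "P B" for B
  proof (rule pairwise_orthogonal_independent)
    show "0 \<notin> B" using that norm_zero zero_neq_one unfolding P_def by metis
  qed (use that in \<open>simp add: P_def\<close>)
  have bound: "finite B \<and> card B \<le> DIM('a)" if "P B" for B
    using independent_bound[OF indep[OF that]] .
  have "P {}" by (simp add: P_def)
  then have "\<exists>B. P B \<and> (\<forall>C. P C \<longrightarrow> card C \<le> card B)"
    by (rule ex_has_greatest_nat[where P = P and f = card and b = "Suc (DIM('a))"])
      (use bound in \<open>simp add: less_Suc_eq_le\<close>)
  then obtain B where B: "P B" and Bmax: "\<And>C. P C \<Longrightarrow> card C \<le> card B" by blast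
  have fin: "finite B" using bound[OF B] by blast
  have "span B = UNIV"
  proof (rule ccontr)
    assume ns: "span B \<noteq> UNIV"
    define V where "V = {x. \<forall>b\<in>B. orthogonal b x}"
    have V: "subspace V" unfolding V_def by (rule subspace_orthogonal_to_vectors)
    have inv: "T x \<in> V" if "x \<in> V" for x
    proof -
      have "b \<bullet> T x = 0" if b: "b \<in> B" for b
      proof -
        obtain l where "T b = l *\<^sub>R b" using B b by (auto simp: P_def)
        then have "b \<bullet> T x = l * (b \<bullet> x)" using adj[of b x] by simp
        also have "b \<bullet> x = 0" using \<open>x \<in> V\<close> b by (simp add: V_def orthogonal_def)
        finally show ?thesis by simp
      qed
      then show ?thesis by (simp add: V_def orthogonal_def)
    qed
    have "span B \<subset> span UNIV" using ns by auto
    then obtain x where x: "x \<noteq> 0" "\<And>y. y \<in> span B \<Longrightarrow> orthogonal x y"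
      using orthogonal_to_subspace_exists_gen by blast
    have "orthogonal b x" if b: "b \<in> B" for b
      using x(2)[OF span_base[OF b]] by (simp add: orthogonal_commute)
    then have "x \<in> V" by (simp add: V_def)
    then have "\<exists>x\<in>V. x \<noteq> 0" using x(1) by blast
    then obtain v l where v: "v \<in> V" "norm v = 1" "T v = l *\<^sub>R v"
      using selfadjoint_eigenvector_exists[OF lin adj V inv] by blast
    have "P (insert v B)"
      using B v unfolding P_def by (auto simp: pairwise_insert V_def orthogonal_commute)
    from Bmax[OF this] have "v \<in> B" using fin by (auto simp: card_insert_if split: if_splits)
    with v show False by (auto simp: V_def orthogonal_def dot_square_norm)
  qed
  then have "card B = DIM('a)"
    using indep[OF B] by (metis basis_card_eq_dim dim_UNIV subset_UNIV)
  with that fin B show ?thesis by (simp add: P_def)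
qed

declare transpose_matrix_vector [simp del]

lemma diag_mat_mult_vec: "(diag_mat d *v x) $ i = d i * x $ i"
  by (simp add: diag_mat_def matrix_vector_mult_def if_distrib if_distribR cong: if_cong)

lemma transpose_diag_mat [simp]: "transpose (diag_mat d) = diag_mat d"
  by (auto simp: diag_mat_def transpose_def vec_eq_iff)

lemma orthogonal_matrix_cancel:
  fixes U :: "real^'n^'n"
  assumes "orthogonal_matrix U"
  shows "U *v (transpose U *v x) = x" "transpose U *v (U *v x) = x"
  using assms
  by (simp_all add: orthogonal_matrix_def matrix_vector_mul_assoc)

lemma symmetric_matrix_diagonalization:
  fixes A :: "real^'n^'n"
  assumes "transpose A = A"
  obtains U d where "orthogonal_matrix U" "A = U ** diag_mat d ** transpose U"
proof -
  have adj: "(A *v x) \<bullet> y = x \<bullet> (A *v y)" for x y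
    using assms by (metis dot_lmul_matrix vector_transpose_matrix)
  obtain B where B: "finite B" "card B = DIM(real^'n)" "pairwise orthogonal B"
    "\<And>b. b \<in> B \<Longrightarrow> norm b = 1 \<and> (\<exists>l. A *v b = l *\<^sub>R b)"
    using selfadjoint_orthonormal_eigenbasis[of "(*v) A"] adj by auto
  then obtain h where h: "bij_betw h (UNIV :: 'n set) B"
    using finite_same_card_bij[of "UNIV :: 'n set" B] by auto
  have hB: "h i \<in> B" for i using h by (auto simp: bij_betw_def)
  have "\<forall>i. \<exists>l. A *v h i = l *\<^sub>R h i" using B(4) hB by blast
  then obtain d where d: "\<And>i. A *v h i = d i *\<^sub>R h i" by metis
  define U :: "real^'n^'n" where "U = (\<chi> i j. h j $ i)"
  have col: "column j U = h j" for j by (simp add: U_def column_def)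
  have inj: "h i \<noteq> h j" if "i \<noteq> j" for i j using h that by (metis bij_betw_def injD)
  have U: "orthogonal_matrix U"
    unfolding orthogonal_matrix_orthonormal_columns col
  proof (intro conjI allI impI)
    show "norm (h i) = 1" for i using B(4)[OF hB] by blast
    show "orthogonal (h i) (h j)" if "i \<noteq> j" for i j
      by (rule pairwiseD[OF B(3) hB hB inj[OF that]])
  qed
  have "A ** U = U ** diag_mat d"
  proof -
    have "(A ** U) $ i $ j = (U ** diag_mat d) $ i $ j" for i j
    proof -
      have "(A ** U) $ i $ j = (A *v h j) $ i"
        by (simp add: matrix_matrix_mult_def matrix_vector_mult_def U_def)
      also have "\<dots> = (U ** diag_mat d) $ i $ j"
        by (simp add: d matrix_matrix_mult_def diag_mat_def U_def if_distrib cong: if_cong)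
      finally show ?thesis .
    qed
    then show ?thesis by (simp add: vec_eq_iff)
  qed
  then have "A = U ** diag_mat d ** transpose U"
    using U by (metis matrix_mul_assoc matrix_mul_rid orthogonal_matrix_def)
  with that U show ?thesis by blast
qed

section \<open>The shifted absolute value\<close>

text \<open>With \<open>W = V\<^sup>T U\<close>, equality of the two products says \<open>W\<^sub>i\<^sub>j d\<^sub>j = e\<^sub>i W\<^sub>i\<^sub>j\<close>, so \<open>d\<^sub>j = e\<^sub>i\<close> wherever
  \<open>W\<^sub>i\<^sub>j \<noteq> 0\<close>, and any function of the eigenvalues inherits the relation.\<close>

lemma diagonalization_map_unique:
  fixes U V :: "real^'n^'n"
  assumes U: "orthogonal_matrix U" and V: "orthogonal_matrix V"
    and eq: "U ** diag_mat d ** transpose U = V ** diag_mat e ** transpose V"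
  shows "U ** diag_mat (\<lambda>i. \<phi> (d i)) ** transpose U = V ** diag_mat (\<lambda>i. \<phi> (e i)) ** transpose V"
proof -
  define W where "W = transpose V ** U"
  have UU: "transpose U ** U = mat 1" "U ** transpose U = mat 1"
    and VV: "transpose V ** V = mat 1" "V ** transpose V = mat 1"
    using U V by (simp_all add: orthogonal_matrix_def)
  have entryR: "(W ** diag_mat d) $ i $ j = W $ i $ j * d j" for d i j
    by (simp add: matrix_matrix_mult_def diag_mat_def if_distrib cong: if_cong)
  have entryL: "(diag_mat d ** W) $ i $ j = d i * W $ i $ j" for d i j
    by (simp add: matrix_matrix_mult_def diag_mat_def if_distrib if_distribR cong: if_cong)
  have "W ** diag_mat d = transpose V ** (U ** diag_mat d ** transpose U) ** U"
    unfolding W_def by (metis UU(1) matrix_mul_assoc matrix_mul_rid)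
  also have "\<dots> = diag_mat e ** W"
    unfolding eq W_def by (metis VV(1) matrix_mul_assoc matrix_mul_lid)
  finally have comm: "W ** diag_mat d = diag_mat e ** W" .
  have "W $ i $ j * d j = e i * W $ i $ j" for i j
    using comm entryR entryL by metis
  then have "W $ i $ j * \<phi> (d j) = \<phi> (e i) * W $ i $ j" for i j
    by (metis mult.commute mult_cancel_right)
  then have comm': "W ** diag_mat (\<lambda>i. \<phi> (d i)) = diag_mat (\<lambda>i. \<phi> (e i)) ** W"
    by (simp add: vec_eq_iff entryR entryL)
  have "U ** diag_mat (\<lambda>i. \<phi> (d i)) ** transpose U
      = V ** (W ** diag_mat (\<lambda>i. \<phi> (d i))) ** transpose U"
    unfolding W_def by (metis VV(2) matrix_mul_assoc matrix_mul_lid)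
  also have "\<dots> = V ** diag_mat (\<lambda>i. \<phi> (e i)) ** transpose V ** (U ** transpose U)"
    unfolding comm' unfolding W_def by (simp only: matrix_mul_assoc)
  finally show ?thesis by (simp add: UU(2))
qed

lemma mat_abs_diagonalization:
  fixes U :: "real^'n^'n"
  assumes "orthogonal_matrix U"
  shows "mat_abs (U ** diag_mat d ** transpose U) = U ** diag_mat (\<lambda>i. \<bar>d i\<bar>) ** transpose U"
  unfolding mat_abs_def
proof (rule the_equality)
  fix B
  assume "\<exists>V e. orthogonal_matrix V \<and>
      U ** diag_mat d ** transpose U = V ** diag_mat e ** transpose V \<and>
      B = V ** diag_mat (\<lambda>i. \<bar>e i\<bar>) ** transpose V"
  then show "B = U ** diag_mat (\<lambda>i. \<bar>d i\<bar>) ** transpose U"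
    using diagonalization_map_unique[OF assms, where \<phi> = abs] by metis
qed (use assms in blast)

lemma eigenvals_diagonalization:
  fixes U :: "real^'n^'n"
  assumes U: "orthogonal_matrix U"
  shows "eigenvals (U ** diag_mat d ** transpose U) = range d"
proof (intro set_eqI iffI)
  fix l assume "l \<in> eigenvals (U ** diag_mat d ** transpose U)"
  then obtain v where v: "v \<noteq> 0" "U *v (diag_mat d *v (transpose U *v v)) = l *\<^sub>R v"
    by (auto simp: eigenvals_def simp flip: matrix_vector_mul_assoc)
  define y where "y = transpose U *v v"
  have "diag_mat d *v y = transpose U *v (l *\<^sub>R v)"
    using v(2) orthogonal_matrix_cancel(2)[OF U] by (metis y_def)
  then have eq: "diag_mat d *v y = l *\<^sub>R y" by (simp add: y_def matrix_vector_mult_scaleR)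
  have "y \<noteq> 0" using v(1) orthogonal_matrix_cancel(1)[OF U, of v] by (auto simp: y_def)
  then obtain i where "y $ i \<noteq> 0" by (auto simp: vec_eq_iff)
  moreover have "d i * y $ i = l * y $ i" using eq by (metis diag_mat_mult_vec vector_scaleR_component real_scaleR_def)
  ultimately show "l \<in> range d" by auto
next
  fix l assume "l \<in> range d"
  then obtain i where i: "l = d i" by blast
  define v where "v = U *v axis i 1"
  have e: "diag_mat d *v axis i 1 = l *\<^sub>R axis i 1"
    by (auto simp: vec_eq_iff diag_mat_mult_vec i axis_def)
  have "(U ** diag_mat d ** transpose U) *v v = U *v (diag_mat d *v (transpose U *v v))"
    by (simp flip: matrix_vector_mul_assoc)
  also have "\<dots> = l *\<^sub>R v"
    by (simp add: v_def orthogonal_matrix_cancel[OF U] e matrix_vector_mult_scaleR)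
  finally have "(U ** diag_mat d ** transpose U) *v v = l *\<^sub>R v" .
  moreover have "v \<noteq> 0"
    using orthogonal_matrix_cancel(2)[OF U, of "axis i 1"] by (auto simp: v_def axis_eq_0_iff)
  ultimately show "l \<in> eigenvals (U ** diag_mat d ** transpose U)"
    by (auto simp: eigenvals_def)
qed

lemma mat_abs_symmetric:
  assumes "transpose A = A"
  shows "transpose (mat_abs A) = mat_abs A"
proof -
  obtain U d where "orthogonal_matrix U" "A = U ** diag_mat d ** transpose U"
    using symmetric_matrix_diagonalization[OF assms] .
  then show ?thesis
    by (simp add: mat_abs_diagonalization matrix_transpose_mul matrix_mul_assoc)
qed

lemma lambda_min_le_quadratic_form:
  fixes A :: "real^'n^'n"
  assumes "transpose A = A"
  shows "lambda_min A * (v \<bullet> v) \<le> v \<bullet> (A *v v)"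
proof -
  obtain U d where U: "orthogonal_matrix U" and A: "A = U ** diag_mat d ** transpose U"
    using symmetric_matrix_diagonalization[OF assms] .
  define y where "y = transpose U *v v"
  have v: "v = U *v y" by (simp add: y_def orthogonal_matrix_cancel[OF U])
  have adj: "(U *v a) \<bullet> b = a \<bullet> (transpose U *v b)" for a b
    by (metis dot_lmul_matrix inner_commute vector_transpose_matrix transpose_transpose)
  have min: "lambda_min A \<le> d i" for i
    unfolding lambda_min_def A eigenvals_diagonalization[OF U] by simp
  have "lambda_min A * (v \<bullet> v) = lambda_min A * (y \<bullet> y)"
    using adj[of y v] by (simp add: v[symmetric] y_def[symmetric])
  also have "\<dots> = (\<Sum>i\<in>UNIV. lambda_min A * (y $ i * y $ i))"
    by (simp add: inner_vec_def sum_distrib_left)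
  also have "\<dots> \<le> (\<Sum>i\<in>UNIV. d i * (y $ i * y $ i))"
    by (intro sum_mono mult_right_mono min) simp
  also have "\<dots> = y \<bullet> (diag_mat d *v y)"
    by (simp add: inner_vec_def diag_mat_mult_vec mult_ac)
  also have "\<dots> = v \<bullet> (A *v v)"
    using adj[of y "A *v v"]
    by (simp add: v[symmetric] A matrix_vector_mul_assoc[symmetric] y_def[symmetric]
        orthogonal_matrix_cancel[OF U])
  finally show ?thesis .
qed

lemma abs_shift_symmetric:
  fixes H :: "real^'n^'n"
  assumes "transpose H = H"
  shows "transpose (abs_shift \<mu> H) = abs_shift \<mu> H"
proof -
  have "transpose (X + c *\<^sub>R mat 1) = transpose X + c *\<^sub>R mat 1" for X :: "real^'n^'n" and c
    by (auto simp: transpose_def vec_eq_iff mat_def)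
  then show ?thesis using mat_abs_symmetric[OF assms] by (simp add: abs_shift_def)
qed

lemma abs_shift_lower_bound:
  fixes H :: "real^'n^'n"
  assumes "transpose H = H"
  shows "\<mu> * (v \<bullet> v) \<le> v \<bullet> (abs_shift \<mu> H *v v)"
proof -
  have q: "lambda_min (mat_abs H) * (v \<bullet> v) \<le> v \<bullet> (mat_abs H *v v)"
    by (rule lambda_min_le_quadratic_form[OF mat_abs_symmetric[OF assms]])
  show ?thesis
  proof (cases "lambda_min (mat_abs H) \<ge> \<mu>")
    case True
    then have "\<mu> * (v \<bullet> v) \<le> lambda_min (mat_abs H) * (v \<bullet> v)" by (intro mult_right_mono) auto
    with q True show ?thesis by (simp add: abs_shift_def)
  next
    case False
    with q show ?thesis
      by (simp add: abs_shift_def matrix_vector_mult_add_rdistrib inner_add_right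
          scaleR_matrix_vector_assoc[symmetric] algebra_simps)
  qed
qed

lemma coercive_matrix_inv:
  fixes H :: "real^'n^'n"
  assumes \<mu>: "\<mu> > 0" and coer: "\<And>v. \<mu> * (v \<bullet> v) \<le> v \<bullet> (H *v v)"
  shows "H *v (matrix_inv H *v v) = v"
proof -
  have "x = 0" if "H *v x = 0" for x
  proof -
    have "\<mu> * (x \<bullet> x) \<le> 0" using coer[of x] that by simp
    then show ?thesis using \<mu> by (simp add: mult_le_0_iff) (metis inner_ge_zero inner_eq_zero_iff order_antisym)
  qed
  then have "invertible H"
    by (metis invertible_left_inverse matrix_left_invertible_ker)
  then have "H ** matrix_inv H = mat 1"
    unfolding invertible_def matrix_inv_def by (metis (mono_tags, lifting) someI_ex)
  then show ?thesis by (simp add: matrix_vector_mul_assoc)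
qed

section \<open>Gradients and Hessians\<close>

lemma differentiable_imp_GDERIV_grad:
  fixes f :: "real^'n \<Rightarrow> real"
  assumes "f differentiable (at x)"
  shows "GDERIV f x :> grad f x"
proof -
  obtain D where D: "(f has_derivative D) (at x)" using assms by (auto simp: differentiable_def)
  have adj: "D h = h \<bullet> adjoint D 1" for h
    using adjoint_works[OF has_derivative_linear[OF D], of h 1] by simp
  then have "D = (\<lambda>h. h \<bullet> adjoint D 1)" by blast
  then have "GDERIV f x :> adjoint D 1" using D by (metis gderiv_def)
  then show ?thesis
    unfolding grad_def
  proof (rule theI)
    fix E assume "GDERIV f x :> E"
    then have "(\<lambda>h. h \<bullet> E) = D" using D has_derivative_unique by (auto simp: gderiv_def)
    then have "h \<bullet> E = h \<bullet> adjoint D 1" for h using adj by metis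
    then show "E = adjoint D 1" by (metis inner_commute vector_eq_rdot)
  qed
qed

lemma GDERIV_imp_grad:
  assumes "GDERIV f x :> D"
  shows "grad f x = D"
proof -
  have "f differentiable (at x)" using assms by (auto simp: gderiv_def differentiable_def)
  then have "(\<lambda>h. h \<bullet> grad f x) = (\<lambda>h. h \<bullet> D)"
    using assms differentiable_imp_GDERIV_grad has_derivative_unique unfolding gderiv_def by blast
  then show ?thesis by (metis inner_commute vector_eq_rdot)
qed

lemma grad_has_derivative_hessian:
  assumes "grad f differentiable (at x)"
  shows "(grad f has_derivative (\<lambda>h. hessian f x *v h)) (at x)"
  using assms unfolding hessian_def by (simp add: jacobian_works)

lemma sample_avg_twice_differentiable:
  fixes F :: "nat \<Rightarrow> real^'n \<Rightarrow> real"
  assumes fin: "finite S" and C2: "\<And>i. i \<in> S \<Longrightarrow> twice_continuously_differentiable (F i)"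
  shows "sample_avg F S differentiable (at x)" "grad (sample_avg F S) differentiable (at x)"
proof -
  let ?G = "\<lambda>x. (1 / real (card S)) *\<^sub>R (\<Sum>i\<in>S. grad (F i) x)"
  have "GDERIV (F i) x :> grad (F i) x" if "i \<in> S" for i x
    using C2[OF that] by (auto simp: twice_continuously_differentiable_def intro: differentiable_imp_GDERIV_grad)
  then have D: "GDERIV (sample_avg F S) x :> ?G x" for x
  proof -
    have "((\<lambda>x. (1 / real (card S)) * (\<Sum>i\<in>S. F i x)) has_derivative
        (\<lambda>h. (1 / real (card S)) * (\<Sum>i\<in>S. h \<bullet> grad (F i) x))) (at x)" for x
      using \<open>\<And>x i. i \<in> S \<Longrightarrow> GDERIV (F i) x :> grad (F i) x\<close>
      by (intro has_derivative_mult_right has_derivative_sum) (auto simp: gderiv_def)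
    then show ?thesis
      unfolding gderiv_def sample_avg_def by (simp add: inner_sum_right)
  qed
  then show "sample_avg F S differentiable (at x)" by (auto simp: gderiv_def differentiable_def)
  have "grad (sample_avg F S) = ?G" using GDERIV_imp_grad[OF D] by blast
  moreover have "?G differentiable (at x)"
    using fin C2 by (intro differentiable_scaleR differentiable_sum)
      (auto simp: twice_continuously_differentiable_def)
  ultimately show "grad (sample_avg F S) differentiable (at x)" by simp
qed

lemma grad_line_derivative:
  fixes f :: "real^'n \<Rightarrow> real"
  assumes "\<And>x. f differentiable (at x)"
  shows "((\<lambda>s. f (x + s *\<^sub>R u)) has_real_derivative u \<bullet> grad f (x + s *\<^sub>R u)) (at s)"
proof -
  have "(f has_derivative (\<lambda>h. h \<bullet> grad f (x + s *\<^sub>R u))) (at (x + s *\<^sub>R u))"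
    using differentiable_imp_GDERIV_grad[OF assms] by (simp add: gderiv_def)
  moreover have "((\<lambda>s. x + s *\<^sub>R u) has_derivative (\<lambda>h. h *\<^sub>R u)) (at s)"
    by (auto intro!: derivative_eq_intros)
  ultimately have "((\<lambda>s. f (x + s *\<^sub>R u)) has_derivative (\<lambda>h. (h *\<^sub>R u) \<bullet> grad f (x + s *\<^sub>R u))) (at s)"
    by (rule has_derivative_compose[rotated])
  then show ?thesis
    by (simp add: has_field_derivative_def mult_commute_abs)
qed

text \<open>The second difference is symmetric in \<open>u\<close> and \<open>v\<close>, hence so is the Hessian. The mean value
  theorem along \<open>u\<close> leaves only a difference of gradients, so differentiability of the gradient at
  the single point \<open>x\<close> suffices.\<close>

lemma second_difference_approx:
  fixes f :: "real^'n \<Rightarrow> real"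
  assumes df: "\<And>x. f differentiable (at x)" and dg: "grad f differentiable (at x)" and e: "e > 0"
  shows "\<exists>\<delta>>0. \<forall>t. 0 < t \<and> t < \<delta> \<longrightarrow>
    \<bar>f (x + t *\<^sub>R u + t *\<^sub>R v) - f (x + t *\<^sub>R u) - f (x + t *\<^sub>R v) + f x - t\<^sup>2 * (u \<bullet> (hessian f x *v v))\<bar>
      \<le> t\<^sup>2 * (e * (norm u * (2 * norm u + norm v)))"
proof -
  let ?H = "hessian f x"
  obtain r where r: "r > 0"
    and R: "\<And>y. norm (y - x) < r \<Longrightarrow> norm (grad f y - grad f x - ?H *v (y - x)) \<le> e * norm (y - x)"
    using grad_has_derivative_hessian[OF dg] e unfolding has_derivative_at_alt by blast
  define \<delta> where "\<delta> = r / (norm u + norm v + 1)"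
  have n1: "norm u + norm v + 1 > 0" by (smt (verit) norm_ge_zero)
  have "\<delta> > 0" using r n1 by (simp add: \<delta>_def)
  moreover have "\<bar>f (x + t *\<^sub>R u + t *\<^sub>R v) - f (x + t *\<^sub>R u) - f (x + t *\<^sub>R v) + f x - t\<^sup>2 * (u \<bullet> (?H *v v))\<bar>
      \<le> t\<^sup>2 * (e * (norm u * (2 * norm u + norm v)))" if t: "0 < t" "t < \<delta>" for t
  proof -
    define \<phi> where "\<phi> s = f ((x + t *\<^sub>R v) + s *\<^sub>R u) - f (x + s *\<^sub>R u)" for s
    have "(\<phi> has_real_derivative
        (u \<bullet> grad f ((x + t *\<^sub>R v) + s *\<^sub>R u) - u \<bullet> grad f (x + s *\<^sub>R u))) (at s)" for s
      unfolding \<phi>_def by (intro DERIV_diff grad_line_derivative df)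
    then obtain s where s: "0 < s" "s < t"
      and mvt: "\<phi> t - \<phi> 0 = t * (u \<bullet> grad f ((x + t *\<^sub>R v) + s *\<^sub>R u) - u \<bullet> grad f (x + s *\<^sub>R u))"
      using MVT2[OF t(1), of \<phi> "\<lambda>s. u \<bullet> grad f ((x + t *\<^sub>R v) + s *\<^sub>R u) - u \<bullet> grad f (x + s *\<^sub>R u)"]
    by auto
    define y1 where "y1 = t *\<^sub>R v + s *\<^sub>R u"
    define y2 where "y2 = s *\<^sub>R u"
    have y2n: "norm y2 \<le> t * norm u" using s by (simp add: y2_def mult_right_mono)
    have y1n: "norm y1 \<le> t * (norm u + norm v)"
      using norm_triangle_ineq[of "t *\<^sub>R v" "s *\<^sub>R u"] y2n t by (simp add: y1_def y2_def algebra_simps)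
    have tr: "t * (norm u + norm v + 1) < r" using t n1 by (simp add: \<delta>_def field_simps)
    have y12: "norm y1 < r" "norm y2 < r"
      using y1n y2n tr t by (smt (verit) mult_left_mono norm_ge_zero)+
    define a1 where "a1 = grad f (x + y1) - grad f x - ?H *v y1"
    define a2 where "a2 = grad f (x + y2) - grad f x - ?H *v y2"
    have a: "norm a1 \<le> e * norm y1" "norm a2 \<le> e * norm y2"
      using R[of "x + y1"] R[of "x + y2"] y12 by (simp_all add: a1_def a2_def)
    have H12: "?H *v y1 - ?H *v y2 = t *\<^sub>R (?H *v v)"
      by (simp add: y1_def y2_def matrix_vector_right_distrib matrix_vector_mult_scaleR)
    have "grad f (x + y1) - grad f (x + y2) = a1 - a2 + (?H *v y1 - ?H *v y2)"
      by (simp add: a1_def a2_def)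
    then have "u \<bullet> grad f (x + y1) - u \<bullet> grad f (x + y2) = u \<bullet> (a1 - a2) + t * (u \<bullet> (?H *v v))"
      unfolding H12 by (metis inner_add_right inner_diff_right inner_scaleR_right)
    then have "\<phi> t - \<phi> 0 = t * (u \<bullet> (a1 - a2)) + t\<^sup>2 * (u \<bullet> (?H *v v))"
      using mvt
      by (simp add: y1_def y2_def add.assoc power2_eq_square right_diff_distrib[symmetric])
        (simp add: algebra_simps)
    moreover have "\<phi> t - \<phi> 0 = f (x + t *\<^sub>R u + t *\<^sub>R v) - f (x + t *\<^sub>R u) - f (x + t *\<^sub>R v) + f x"
      by (simp add: \<phi>_def add_ac)
    moreover have "\<bar>t * (u \<bullet> (a1 - a2))\<bar> \<le> t\<^sup>2 * (e * (norm u * (2 * norm u + norm v)))"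
    proof -
      have "norm (a1 - a2) \<le> norm a1 + norm a2" by (rule norm_triangle_ineq4)
      also have "\<dots> \<le> e * norm y1 + e * norm y2" using a by simp
      also have "\<dots> \<le> e * (t * (norm u + norm v)) + e * (t * norm u)"
        using y1n y2n e by (intro add_mono mult_left_mono) auto
      also have "\<dots> = t * (e * (2 * norm u + norm v))" by (simp add: algebra_simps)
      finally have "\<bar>u \<bullet> (a1 - a2)\<bar> \<le> norm u * (t * (e * (2 * norm u + norm v)))"
        by (meson Cauchy_Schwarz_ineq2 mult_left_mono norm_ge_zero order_trans)
      then have "t * \<bar>u \<bullet> (a1 - a2)\<bar> \<le> t * (norm u * (t * (e * (2 * norm u + norm v))))"
        using t by (intro mult_left_mono) auto
      then show ?thesis using t by (simp add: abs_mult power2_eq_square mult_ac)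
    qed
    ultimately show ?thesis by simp
  qed
  ultimately show ?thesis by blast
qed

lemma hessian_inner_commute:
  fixes f :: "real^'n \<Rightarrow> real"
  assumes df: "\<And>x. f differentiable (at x)" and dg: "grad f differentiable (at x)"
  shows "u \<bullet> (hessian f x *v v) = v \<bullet> (hessian f x *v u)"
proof -
  let ?d = "\<bar>u \<bullet> (hessian f x *v v) - v \<bullet> (hessian f x *v u)\<bar>"
  define C where "C = norm u * (2 * norm u + norm v) + norm v * (2 * norm v + norm u)"
  have le: "?d \<le> e * C" if e: "e > 0" for e
  proof -
    obtain \<delta>1 where d1: "\<delta>1 > 0" and D1: "\<And>t. 0 < t \<and> t < \<delta>1 \<Longrightarrow>
      \<bar>f (x + t *\<^sub>R u + t *\<^sub>R v) - f (x + t *\<^sub>R u) - f (x + t *\<^sub>R v) + f x - t\<^sup>2 * (u \<bullet> (hessian f x *v v))\<bar>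
      \<le> t\<^sup>2 * (e * (norm u * (2 * norm u + norm v)))"
      using second_difference_approx[OF df dg e, of u v] by blast
    obtain \<delta>2 where d2: "\<delta>2 > 0" and D2: "\<And>t. 0 < t \<and> t < \<delta>2 \<Longrightarrow>
      \<bar>f (x + t *\<^sub>R v + t *\<^sub>R u) - f (x + t *\<^sub>R v) - f (x + t *\<^sub>R u) + f x - t\<^sup>2 * (v \<bullet> (hessian f x *v u))\<bar>
      \<le> t\<^sup>2 * (e * (norm v * (2 * norm v + norm u)))"
      using second_difference_approx[OF df dg e, of v u] by blast
    define t where "t = min \<delta>1 \<delta>2 / 2"
    have t: "0 < t" "t < \<delta>1" "t < \<delta>2" using d1 d2 by (auto simp: t_def min_def)
    have comm: "x + t *\<^sub>R v + t *\<^sub>R u = x + t *\<^sub>R u + t *\<^sub>R v" by (simp add: add_ac)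
    have "\<bar>t\<^sup>2 * (u \<bullet> (hessian f x *v v)) - t\<^sup>2 * (v \<bullet> (hessian f x *v u))\<bar>
        \<le> t\<^sup>2 * (e * (norm u * (2 * norm u + norm v))) + t\<^sup>2 * (e * (norm v * (2 * norm v + norm u)))"
      using D1[of t] D2[of t] t unfolding comm by linarith
    moreover have "\<bar>t\<^sup>2 * (u \<bullet> (hessian f x *v v)) - t\<^sup>2 * (v \<bullet> (hessian f x *v u))\<bar> = t\<^sup>2 * ?d"
      by (simp add: abs_mult flip: right_diff_distrib)
    ultimately have "t\<^sup>2 * ?d \<le> t\<^sup>2 * (e * C)"
      unfolding C_def distrib_left by linarith
    then show ?thesis using t by simp
  qed
  have "C \<ge> 0" by (simp add: C_def)
  have "?d \<le> 0 + e" if e: "e > 0" for e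
  proof -
    have "?d \<le> e / (C + 1) * C" using le[of "e / (C + 1)"] e \<open>C \<ge> 0\<close> by simp
    also have "\<dots> \<le> e" using e \<open>C \<ge> 0\<close> by (simp add: field_simps)
    finally show ?thesis by simp
  qed
  then have "?d \<le> 0" by (rule field_le_epsilon)
  then show ?thesis by simp
qed

lemma symmetric_if_inner_commute:
  fixes A :: "real^'n^'n"
  assumes "\<And>u v. u \<bullet> (A *v v) = v \<bullet> (A *v u)"
  shows "transpose A = A"
proof -
  have "A $ i $ j = A $ j $ i" for i j
    using assms[of "axis i 1" "axis j 1"]
    by (simp add: inner_axis' matrix_vector_mul_component inner_axis)
  then show ?thesis by (simp add: transpose_def vec_eq_iff)
qed

lemma hess_avg_symmetric:
  fixes F :: "nat \<Rightarrow> real^'n \<Rightarrow> real"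
  assumes "\<And>i. i \<in> {1..N} \<Longrightarrow> twice_continuously_differentiable (F i)"
    and "\<And>k. S k \<subseteq> {1..N}"
  shows "transpose (hess_avg F S \<gamma> w k) = hess_avg F S \<gamma> w k"
proof -
  have "hessian (sample_avg F (S j)) x $ a $ b = hessian (sample_avg F (S j)) x $ b $ a" for j x a b
  proof -
    have "transpose (hessian (sample_avg F (S j)) x) = hessian (sample_avg F (S j)) x"
      using assms sample_avg_twice_differentiable[of "S j" F] finite_subset[of "S j" "{1..N}"]
      by (intro symmetric_if_inner_commute hessian_inner_commute) blast+
    then show ?thesis by (metis transpose_def vec_lambda_beta)
  qed
  then show ?thesis by (simp add: hess_avg_def transpose_def vec_eq_iff)
qed

section \<open>Descent\<close>

lemma hessian_bound_imp_descent:
  fixes f :: "real^'n \<Rightarrow> real"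
  assumes df: "\<And>x. f differentiable (at x)" and dg: "\<And>x. grad f differentiable (at x)"
    and H: "\<And>x. hessian f x \<preceq> L *\<^sub>R mat 1"
  shows "f (x + d) \<le> f x + d \<bullet> grad f x + L / 2 * (d \<bullet> d)"
proof -
  define p where "p t = d \<bullet> grad f (x + t *\<^sub>R d)" for t
  have p': "(p has_real_derivative d \<bullet> (hessian f (x + t *\<^sub>R d) *v d)) (at t)" for t
  proof -
    have "((\<lambda>t. x + t *\<^sub>R d) has_derivative (\<lambda>h. h *\<^sub>R d)) (at t)"
      by (auto intro!: derivative_eq_intros)
    then have "((\<lambda>t. grad f (x + t *\<^sub>R d)) has_derivative (\<lambda>h. hessian f (x + t *\<^sub>R d) *v (h *\<^sub>R d))) (at t)"
      by (rule has_derivative_compose[OF _ grad_has_derivative_hessian[OF dg]])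
    from has_derivative_inner_right[OF this, of d] show ?thesis
      unfolding p_def by (simp add: has_field_derivative_def matrix_vector_mult_scaleR mult_commute_abs)
  qed
  have Hd: "d \<bullet> (hessian f y *v d) \<le> L * (d \<bullet> d)" for y
    using H[of y] by (simp add: psd_le_def scaleR_matrix_vector_assoc[symmetric])
  have p_le: "p t \<le> p 0 + t * (L * (d \<bullet> d))" if "t \<ge> 0" for t
  proof -
    have "p t - t * (L * (d \<bullet> d)) \<le> p 0 - 0 * (L * (d \<bullet> d))"
    proof (rule DERIV_nonpos_imp_nonincreasing[OF that])
      fix s
      have "((\<lambda>t. p t - t * (L * (d \<bullet> d))) has_real_derivative
          d \<bullet> (hessian f (x + s *\<^sub>R d) *v d) - L * (d \<bullet> d)) (at s)"
        by (auto intro!: derivative_eq_intros p')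
      then show "\<exists>y. ((\<lambda>t. p t - t * (L * (d \<bullet> d))) has_real_derivative y) (at s) \<and> y \<le> 0"
        using Hd[of "x + s *\<^sub>R d"] by (intro exI conjI) auto
    qed
    then show ?thesis by simp
  qed
  define q where "q t = f (x + t *\<^sub>R d) - t * p 0 - t\<^sup>2 / 2 * (L * (d \<bullet> d))" for t
  have "q 1 \<le> q 0"
  proof (rule DERIV_nonpos_imp_nonincreasing[where f = q and a = 0 and b = 1])
    fix s :: real assume s: "0 \<le> s"
    have "(q has_real_derivative p s - p 0 - s * (L * (d \<bullet> d))) (at s)"
      unfolding q_def p_def by (auto intro!: derivative_eq_intros grad_line_derivative df)
    then show "\<exists>y. (q has_real_derivative y) (at s) \<and> y \<le> 0"
      using p_le[OF s] by (intro exI conjI) auto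
  qed simp
  then show ?thesis by (simp add: q_def p_def)
qed

text \<open>The lower bound on the inverse comes from \<open>0 \<le> (M y - v) \<bullet> H (M y - v)\<close> with \<open>y = H\<^sup>-\<^sup>1 v\<close>.\<close>

lemma inverse_quadratic_form_bounds:
  fixes H :: "real^'n^'n"
  assumes \<mu>: "\<mu> > 0" and coer: "\<And>v. \<mu> * (v \<bullet> v) \<le> v \<bullet> (H *v v)"
    and sym: "transpose H = H" and up: "H \<preceq> M *\<^sub>R mat 1"
  defines "A \<equiv> matrix_inv H"
  shows "\<mu> * ((A *v v) \<bullet> (A *v v)) \<le> v \<bullet> (A *v v)"
    and "v \<bullet> v \<le> M * (v \<bullet> (A *v v))"
    and "u \<bullet> (A *v v) = v \<bullet> (A *v u)"
    and "M > 0"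
proof -
  have HA: "H *v (A *v v) = v" for v
    unfolding A_def by (rule coercive_matrix_inv[OF \<mu> coer])
  have adj: "(H *v x) \<bullet> y = x \<bullet> (H *v y)" for x y
    using sym by (metis dot_lmul_matrix vector_transpose_matrix)
  show "\<mu> * ((A *v v) \<bullet> (A *v v)) \<le> v \<bullet> (A *v v)"
    using coer[of "A *v v"] by (simp add: HA inner_commute)
  show "u \<bullet> (A *v v) = v \<bullet> (A *v u)"
    using adj[of "A *v u" "A *v v"] by (simp add: HA inner_commute)
  have up': "x \<bullet> (H *v x) \<le> M * (x \<bullet> x)" for x
    using up by (simp add: psd_le_def scaleR_matrix_vector_assoc[symmetric])
  have "\<mu> \<le> M"
    using coer[of "axis undefined 1"] up'[of "axis undefined 1"] by (simp add: inner_axis_axis)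
  then show M: "M > 0" using \<mu> by simp
  let ?y = "A *v v"
  let ?z = "M *\<^sub>R ?y - v"
  have "0 \<le> ?z \<bullet> (H *v ?z)"
    using coer[of ?z] \<mu> by (smt (verit) inner_ge_zero mult_nonneg_nonneg)
  also have "?z \<bullet> (H *v ?z) = M * M * (v \<bullet> ?y) - 2 * M * (v \<bullet> v) + v \<bullet> (H *v v)"
    using adj[of ?y v]
    by (simp add: matrix_vector_mult_diff_distrib matrix_vector_mult_scaleR HA inner_simps
        inner_commute algebra_simps)
  also have "\<dots> \<le> M * (M * (v \<bullet> ?y) - v \<bullet> v)"
    using up'[of v] by (simp add: algebra_simps)
  finally show "v \<bullet> v \<le> M * (v \<bullet> ?y)" using M by (simp add: zero_le_mult_iff)
qed

lemma quasi_newton_step_descent: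
  fixes f :: "real^'n \<Rightarrow> real" and A :: "real^'n^'n"
  assumes desc: "\<And>x d. f (x + d) \<le> f x + d \<bullet> grad f x + L / 2 * (d \<bullet> d)"
    and Ag: "\<mu> * ((A *v g) \<bullet> (A *v g)) \<le> g \<bullet> (A *v g)"
    and Asym: "\<And>u v. u \<bullet> (A *v v) = v \<bullet> (A *v u)"
    and \<mu>: "\<mu> > 0" and L: "L > 0" and \<alpha>: "0 < \<alpha>" "\<alpha> \<le> \<mu> / L"
  shows "f (x - \<alpha> *\<^sub>R (A *v g))
    \<le> f x - \<alpha> / 2 * (grad f x \<bullet> (A *v grad f x))
        + \<alpha> / 2 * ((g - grad f x) \<bullet> (A *v (g - grad f x)))"
proof -
  let ?G = "grad f x" and ?y = "A *v g"
  have "L * \<alpha> * (?y \<bullet> ?y) \<le> \<mu> * (?y \<bullet> ?y)"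
    using \<alpha> L by (intro mult_right_mono) (auto simp: field_simps)
  then have "L * \<alpha> * (?y \<bullet> ?y) \<le> g \<bullet> ?y" using Ag by simp
  then have 1: "\<alpha> / 2 * (L * \<alpha> * (?y \<bullet> ?y)) \<le> \<alpha> / 2 * (g \<bullet> ?y)"
    using \<alpha> by (intro mult_left_mono) auto
  have "f (x - \<alpha> *\<^sub>R ?y) \<le> f x - \<alpha> * (?G \<bullet> ?y) + \<alpha> / 2 * (L * \<alpha> * (?y \<bullet> ?y))"
    using desc[of x "- (\<alpha> *\<^sub>R ?y)"] by (simp add: inner_commute algebra_simps)
  also have "\<dots> \<le> f x - \<alpha> * (?G \<bullet> ?y) + \<alpha> / 2 * (g \<bullet> ?y)" using 1 by simp
  also have "\<dots> = f x - \<alpha> / 2 * (?G \<bullet> (A *v ?G)) + \<alpha> / 2 * ((g - ?G) \<bullet> (A *v (g - ?G)))"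
    using Asym[of g ?G] by (simp add: matrix_vector_mult_diff_distrib inner_simps algebra_simps)
  finally show ?thesis .
qed

lemma telescoping_descent_sum:
  fixes \<phi> a \<iota> :: "nat \<Rightarrow> real"
  assumes step: "\<And>k. \<phi> (Suc k) \<le> \<phi> k - c * a k + \<iota> k"
    and low: "\<And>k. m \<le> \<phi> k" and \<iota>: "\<And>k. 0 \<le> \<iota> k" "\<iota> sums s" and c: "c > 0"
  shows "(\<Sum>k<T. a k) \<le> (\<phi> 0 - m + s) / c"
proof -
  have "\<phi> T + c * (\<Sum>k<T. a k) \<le> \<phi> 0 + (\<Sum>k<T. \<iota> k)"
  proof (induction T)
    case (Suc T)
    then show ?case using step[of T] by (simp add: algebra_simps)
  qed simp
  moreover have "(\<Sum>k<T. \<iota> k) \<le> s"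
    using \<iota> by (metis finite_lessThan sum_le_suminf sums_iff)
  ultimately have "c * (\<Sum>k<T. a k) \<le> \<phi> 0 - m + s" using low[of T] by simp
  then show ?thesis using c by (simp add: pos_le_divide_eq mult.commute)
qed

lemma tendsto_0_if_partial_sums_bounded:
  fixes a :: "nat \<Rightarrow> real"
  assumes "\<And>k. 0 \<le> a k" "\<And>T. (\<Sum>k<T. a k) \<le> C"
  shows "a \<longlonglongrightarrow> 0"
  using assms by (intro summable_LIMSEQ_zero summableI_nonneg_bounded)

lemma Min_le_average:
  fixes a :: "nat \<Rightarrow> real"
  assumes "T > 0" "(\<Sum>k<T. a k) \<le> C"
  shows "(MIN k\<in>{0..T-1}. a k) \<le> C / real T"
proof -
  have "real T * (MIN k\<in>{0..T-1}. a k) = (\<Sum>k<T. (MIN k\<in>{0..T-1}. a k))" by simp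
  also have "\<dots> \<le> (\<Sum>k<T. a k)" by (intro sum_mono Min_le) auto
  finally show ?thesis using assms by (simp add: pos_le_divide_eq mult.commute)
qed

theorem theorem3p3:
  fixes N :: nat
    and F :: "nat \<Rightarrow> real^'n \<Rightarrow> real"
    and f :: "real^'n \<Rightarrow> real"
    and S :: "nat \<Rightarrow> nat set"
    and \<gamma> :: "nat \<Rightarrow> nat \<Rightarrow> real"
    and w g :: "nat \<Rightarrow> real^'n"
    and w0 :: "real^'n"
    and Ht A :: "nat \<Rightarrow> real^'n^'n"
    and \<alpha>s \<theta> \<iota> :: "nat \<Rightarrow> real"
    and L Lt \<mu>t fmin \<alpha> \<theta>g \<iota>t :: real
  assumes N: "N \<ge> 1"
    and C2: "\<And>i. i \<in> {1..N} \<Longrightarrow> twice_continuously_differentiable (F i)"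
    and f: "\<And>x. f x = (1 / real N) * (\<Sum>i=1..N. F i x)"
    and upper: "spectral_upper_bound N F L"
    and bdd: "\<And>x. fmin \<le> f x"
    and S: "\<And>k. S k \<subseteq> {1..N} \<and> S k \<noteq> {}"
    and \<gamma>01: "\<And>k i. i \<le> k \<Longrightarrow> 0 \<le> \<gamma> k i \<and> \<gamma> k i \<le> 1"
    and \<gamma>sum: "\<And>k. (\<Sum>i\<le>k. \<gamma> k i) = 1"
    and \<mu>t: "\<mu>t > 0"
    and Ht: "\<And>k. Ht k = abs_shift \<mu>t (hess_avg F S \<gamma> w k)"
    and Lt: "\<And>k. Ht k \<preceq> Lt *\<^sub>R mat 1"
    and w_0: "w 0 = w0"
    and w_Suc: "\<And>k. w (Suc k) = w k - \<alpha>s k *\<^sub>R (matrix_inv (Ht k) *v g k)"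
    and A: "\<And>k. A k = matrix_inv (Ht k)"
    and norm_cond: "\<And>k. (mnorm (A k) (g k - grad f (w k)))\<^sup>2
                        \<le> (\<theta> k)\<^sup>2 * (mnorm (A k) (grad f (w k)))\<^sup>2 + \<iota> k"
    and \<theta>: "\<And>k. \<theta> k = \<theta>g" "0 \<le> \<theta>g" "\<theta>g < 1"
    and \<iota>: "\<And>k. \<iota> k > 0" "\<iota> sums \<iota>t"
    and \<alpha>: "\<And>k. \<alpha>s k = \<alpha>" "0 < \<alpha>" "\<alpha> \<le> \<mu>t / L"
  shows "(\<lambda>k. (norm (grad f (w k)))\<^sup>2) \<longlonglongrightarrow> 0 \<and>
    (\<forall>T::nat. T > 0 \<longrightarrow>
       (MIN k\<in>{0..T-1}. (norm (grad f (w k)))\<^sup>2)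
         \<le> Lt / ((1 - \<theta>g\<^sup>2) * real T) * (2 * (f w0 - fmin) / \<alpha> + \<iota>t))"
proof -
  have favg: "f = sample_avg F {1..N}" using f by (auto simp: sample_avg_def)
  have df: "f differentiable (at x)" and dg: "grad f differentiable (at x)" for x
    using sample_avg_twice_differentiable[of "{1..N}" F] C2 by (simp_all add: favg)
  obtain Ls where Ls: "\<And>s. s \<in> {1..N} \<Longrightarrow> 0 < Ls s \<and> Ls s \<le> L"
    and Hs: "\<And>R x. R \<subseteq> {1..N} \<Longrightarrow> R \<noteq> {} \<Longrightarrow> hessian (sample_avg F R) x \<preceq> Ls (card R) *\<^sub>R mat 1"
    using upper unfolding spectral_upper_bound_def by meson
  have LN: "0 < Ls N" "Ls N \<le> L" using Ls[of N] N by auto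
  then have L: "L > 0" by simp
  have HL: "hessian f x \<preceq> L *\<^sub>R mat 1" for x
  proof -
    have "v \<bullet> (hessian f x *v v) \<le> Ls N * (v \<bullet> v)" for v
      using Hs[of "{1..N}" x] N by (simp add: favg psd_le_def scaleR_matrix_vector_assoc[symmetric])
    moreover have "Ls N * (v \<bullet> v) \<le> L * (v \<bullet> v)" for v :: "real^'n"
      using LN by (intro mult_right_mono) auto
    ultimately show ?thesis
      unfolding psd_le_def by (simp add: scaleR_matrix_vector_assoc[symmetric]) (meson order_trans)
  qed
  have Hsym: "transpose (hess_avg F S \<gamma> w k) = hess_avg F S \<gamma> w k" for k
    using hess_avg_symmetric[of N F S] C2 S by blast
  have coer: "\<mu>t * (v \<bullet> v) \<le> v \<bullet> (Ht k *v v)" and sym: "transpose (Ht k) = Ht k" for k v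
    unfolding Ht by (rule abs_shift_lower_bound[OF Hsym], rule abs_shift_symmetric[OF Hsym])
  note bounds = inverse_quadratic_form_bounds[OF \<mu>t coer sym Lt, folded A]
  have Lt0: "Lt > 0" by (rule bounds(4))
  have th: "1 - \<theta>g\<^sup>2 > 0" using \<theta> by (simp add: power_less_one_iff)
  let ?a = "\<lambda>k. (norm (grad f (w k)))\<^sup>2"
  define c where "c = \<alpha> / 2 * ((1 - \<theta>g\<^sup>2) / Lt)"
  have c: "c > 0" using \<alpha>(2) th Lt0 by (simp add: c_def)
  have mnorm: "(mnorm (A k) v)\<^sup>2 = v \<bullet> (A k *v v)" for k v
  proof -
    have "0 \<le> \<mu>t * ((A k *v v) \<bullet> (A k *v v))" using \<mu>t by simp
    then show ?thesis unfolding mnorm_def using bounds(1)[of k v] by simp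
  qed
  have step: "f (w (Suc k)) \<le> f (w k) - c * ?a k + \<alpha> / 2 * \<iota> k" for k
  proof -
    let ?G = "grad f (w k)"
    let ?q = "?G \<bullet> (A k *v ?G)"
    have "f (w (Suc k)) \<le> f (w k) - \<alpha> / 2 * ?q
        + \<alpha> / 2 * ((g k - ?G) \<bullet> (A k *v (g k - ?G)))"
      unfolding w_Suc \<alpha>(1) A[symmetric]
      by (rule quasi_newton_step_descent[OF hessian_bound_imp_descent[OF df dg HL]
            bounds(1) bounds(3) \<mu>t L \<alpha>(2,3)])
    also have "\<dots> \<le> f (w k) - \<alpha> / 2 * ?q + \<alpha> / 2 * (\<theta>g\<^sup>2 * ?q + \<iota> k)"
      using norm_cond[of k] \<alpha>(2) by (simp add: mnorm \<theta>(1))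
    also have "\<dots> = f (w k) - \<alpha> / 2 * ((1 - \<theta>g\<^sup>2) * ?q) + \<alpha> / 2 * \<iota> k"
      by (simp add: algebra_simps)
    also have "\<dots> \<le> f (w k) - c * ?a k + \<alpha> / 2 * \<iota> k"
    proof -
      have "?a k / Lt \<le> ?q"
        using bounds(2)[of "?G" k] Lt0 by (simp add: dot_square_norm divide_simps mult.commute)
      then have "\<alpha> / 2 * ((1 - \<theta>g\<^sup>2) * (?a k / Lt)) \<le> \<alpha> / 2 * ((1 - \<theta>g\<^sup>2) * ?q)"
        using \<alpha>(2) th by (intro mult_left_mono) auto
      then show ?thesis by (simp add: c_def)
    qed
    finally show ?thesis .
  qed
  define C where "C = Lt / (1 - \<theta>g\<^sup>2) * (2 * (f w0 - fmin) / \<alpha> + \<iota>t)"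
  have sums: "(\<Sum>k<T. ?a k) \<le> C" for T
  proof -
    have "(\<Sum>k<T. ?a k) \<le> (f (w 0) - fmin + \<alpha> / 2 * \<iota>t) / c"
    proof (rule telescoping_descent_sum[where \<phi> = "\<lambda>k. f (w k)" and \<iota> = "\<lambda>k. \<alpha> / 2 * \<iota> k"])
      show "0 \<le> \<alpha> / 2 * \<iota> k" for k using \<iota>(1)[of k] \<alpha>(2) by simp
      show "(\<lambda>k. \<alpha> / 2 * \<iota> k) sums (\<alpha> / 2 * \<iota>t)" by (rule sums_mult[OF \<iota>(2)])
    qed (use step bdd c in auto)
    also have "\<dots> = C" using \<alpha>(2) th Lt0 by (simp add: C_def c_def w_0 divide_simps)
    finally show ?thesis .
  qed
  have "?a \<longlonglongrightarrow> 0"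
    by (rule tendsto_0_if_partial_sums_bounded[OF _ sums]) simp
  moreover have "(MIN k\<in>{0..T-1}. ?a k)
      \<le> Lt / ((1 - \<theta>g\<^sup>2) * real T) * (2 * (f w0 - fmin) / \<alpha> + \<iota>t)" if "T > 0" for T
    using Min_le_average[OF that sums] by (simp add: C_def)
  ultimately show ?thesis by blast
qed

end
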